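(* Let $u\ge \ell\ge 1$ and $m\ge 1$ be integers with $m\le 2^u$, let $n\coloneqq 2^\ell$, and let $\mathcal{H}$ be the set of all linear maps $\mathbb{F}_2^u\to\mathbb{F}_2^\ell$. For any $S\subseteq \mathbb{F}_2^u$ of cardinality $m$, if $h$ is drawn uniformly at random from $\mathcal{H}$, then \[\mathbb{E}_{h\sim \mathcal{H}}\left[\max_{y\in \mathbb{F}_2^\ell} |h^{-1}(y)\cap S|\right] \le 16\cdot \textsc{opt}(m,n).\]
   Context: $\log$ denotes the base-2 logarithm. For positive integers $m,n$ define \[\textsc{opt}(m,n) = \begin{cases}\dfrac{\log n}{\log\left(\frac{n\log n}{m}\right)} & m\le \frac{1}{2}n\log n, \\[2mm] \dfrac{m}{n} & m > \frac{1}{2} n\log n.\end{cases}\] *)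

theory Defs
  imports "HOL-Probability.Probability" "HOL-Library.Z2"
begin

definition opt :: "nat \<Rightarrow> nat \<Rightarrow> real" where
  "opt m n =
    (if real m \<le> 1 / 2 * real n * log 2 (real n)
     then log 2 (real n) / log 2 (real n * log 2 (real n) / real m)
     else real m / real n)"

definition linear_maps :: "(bit ^ 'u \<Rightarrow> bit ^ 'l) set" where
  "linear_maps = {h. Vector_Spaces.linear (*s) (*s) h}"

instance bit :: finite
proof
  have "(UNIV :: bit set) \<subseteq> {0, 1}"
    using bit.exhaust by blast
  then show "finite (UNIV :: bit set)"
    by (rule finite_subset) simp
qed

text \<open>
  Finiteness and nonemptiness make \<^const>\<open>pmf_of_set\<close> of this set the uniform distribution
  (it is unspecified for other sets).
\<close>

lemma finite_linear_maps: "finite (linear_maps :: (bit ^ 'u \<Rightarrow> bit ^ 'l) set)"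
  by (rule finite_subset[OF subset_UNIV]) simp

lemma linear_maps_nonempty: "(linear_maps :: (bit ^ 'u \<Rightarrow> bit ^ 'l) set) \<noteq> {}"
proof -
  have "(\<lambda>_. 0) \<in> (linear_maps :: (bit ^ 'u \<Rightarrow> bit ^ 'l) set)"
    unfolding linear_maps_def
    by (simp add: vec.linear_0 vec.linear_zero)
  then show ?thesis by blast
qed

end

theory Submission
  imports Defs
begin

text \<open>
  For \<open>b > 1\<close> let \<open>P\<^sub>T(h)\<close> be the average of \<open>b ^ |h\<^sup>-\<^sup>1(y) \<inter> T|\<close> over the \<open>n\<close> points \<open>y\<close>, the
  probability generating function of the load of a uniformly random point.  Adding a constant
  \<open>a\<close> to \<open>h\<close> on a set \<open>A\<close> translates the loads of \<open>T \<inter> A\<close> by \<open>a\<close> and fixes those of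
  \<open>T - A\<close>, so averaging over \<open>a\<close> turns \<open>P\<^sub>T\<close> into \<open>P\<^bsub>T \<inter> A\<^esub> P\<^bsub>T - A\<^esub>\<close>.  If the distribution of \<open>h\<close>
  is invariant under these shifts, as it is for a uniform linear map and \<open>A = {x. x\<^sub>i = 1}\<close>, then
  Jensen's inequality makes \<open>E ln P\<^sub>T\<close> subadditive under splitting \<open>T\<close> by \<open>A\<close>.  Splitting down to
  singletons gives \<open>E ln P\<^sub>T \<le> |T| (b - 1) / n\<close>.  As \<open>b\<close> to the power of the maximum load is at most
  \<open>n P\<^sub>T\<close>, the expected maximum load is at most \<open>(ln n + |T| (b - 1) / n) / ln b\<close>; choose
  \<open>b = n log n / |T|\<close> for small \<open>|T|\<close> and \<open>b = 2\<close> for large \<open>|T|\<close>.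
\<close>

definition load :: "'a set \<Rightarrow> ('a \<Rightarrow> 'b) \<Rightarrow> 'b \<Rightarrow> nat" where
  "load T h y = card (h -` {y} \<inter> T)"

definition max_load :: "'a set \<Rightarrow> ('a \<Rightarrow> 'b) \<Rightarrow> nat" where
  "max_load T h = (MAX y\<in>UNIV. load T h y)"

definition load_pgf :: "real \<Rightarrow> 'a set \<Rightarrow> ('a \<Rightarrow> 'b) \<Rightarrow> real" where
  "load_pgf b T h = (\<Sum>y\<in>UNIV. b ^ load T h y) / CARD('b)"

lemma load_le_card: "finite T \<Longrightarrow> load T h y \<le> card T"
  by (simp add: load_def card_mono)

lemma sum_load:
  fixes h :: "'a \<Rightarrow> 'b::finite"
  assumes "finite T"
  shows "(\<Sum>y\<in>UNIV. load T h y) = card T"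
proof -
  have "load T h y = card {x \<in> T. h x = y}" for y
    by (auto simp: load_def intro: arg_cong[of _ _ card])
  then show ?thesis
    using sum_multicount[of UNIV T "\<lambda>y x. h x = y" 1] assms by simp
qed

lemma max_load_attained:
  fixes h :: "'a \<Rightarrow> 'b::finite"
  obtains y where "max_load T h = load T h y"
proof -
  have "max_load T h \<in> range (load T h)"
    unfolding max_load_def by (rule Max_in) auto
  then show thesis
    using that by blast
qed

lemma max_load_le_card:
  fixes h :: "'a \<Rightarrow> 'b::finite"
  assumes "finite T"
  shows "max_load T h \<le> card T"
  using max_load_attained[of T h] load_le_card[OF assms] by metis

lemma power_max_load_le_load_pgf:
  fixes b :: real and h :: "'a \<Rightarrow> 'b::finite"
  assumes "b \<ge> 0"
  shows "b ^ max_load T h \<le> CARD('b) * load_pgf b T h"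
proof -
  obtain y where "max_load T h = load T h y"
    by (rule max_load_attained)
  moreover have "b ^ load T h y \<le> (\<Sum>y\<in>UNIV. b ^ load T h y)"
    using assms by (intro member_le_sum) auto
  ultimately show ?thesis
    by (simp add: load_pgf_def)
qed

lemma load_pgf_pos:
  fixes b :: real and h :: "'a \<Rightarrow> 'b::finite"
  assumes "b > 0"
  shows "load_pgf b T h > 0"
  unfolding load_pgf_def using assms by (intro divide_pos_pos sum_pos) auto

lemma max_load_le_ln_load_pgf:
  fixes b :: real and h :: "'a \<Rightarrow> 'b::finite"
  assumes "b > 1"
  shows "max_load T h \<le> (ln CARD('b) + ln (load_pgf b T h)) / ln b"
proof -
  have "ln (b ^ max_load T h) \<le> ln (CARD('b) * load_pgf b T h)"
    using assms by (intro ln_mono power_max_load_le_load_pgf) auto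
  also have "\<dots> = ln CARD('b) + ln (load_pgf b T h)"
    using assms by (simp add: ln_mult_pos load_pgf_pos)
  finally show ?thesis
    using assms by (simp add: ln_realpow pos_le_divide_eq)
qed

lemma load_pgf_ge_1:
  fixes b :: real and h :: "'a \<Rightarrow> 'b::finite"
  assumes "b \<ge> 1"
  shows "load_pgf b T h \<ge> 1"
proof -
  have "(\<Sum>y\<in>(UNIV :: 'b set). 1) \<le> (\<Sum>y\<in>UNIV. b ^ load T h y)"
    using assms by (intro sum_mono one_le_power)
  then show ?thesis
    by (simp add: load_pgf_def)
qed

lemma load_pgf_le_power_card:
  fixes b :: real and h :: "'a \<Rightarrow> 'b::finite"
  assumes "b \<ge> 1" "finite T"
  shows "load_pgf b T h \<le> b ^ card T"
proof -
  have "(\<Sum>y\<in>UNIV. b ^ load T h y) \<le> (\<Sum>y\<in>(UNIV :: 'b set). b ^ card T)"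
    using assms by (intro sum_mono power_increasing load_le_card)
  then show ?thesis
    by (simp add: load_pgf_def field_simps)
qed

lemma load_pgf_inj_on:
  fixes b :: real and h :: "'a \<Rightarrow> 'b::finite"
  assumes "inj_on h T" "finite T"
  shows "load_pgf b T h = 1 + card T * (b - 1) / CARD('b)"
proof -
  have "b ^ load T h y = 1 + load T h y * (b - 1)" for y
  proof -
    have "load T h y \<le> 1"
      unfolding load_def using card_vimage_inj_on_le[OF assms(1), of "{y}"] by simp
    then consider "load T h y = 0" | "load T h y = 1"
      by linarith
    then show ?thesis
      by cases simp_all
  qed
  then have "(\<Sum>y\<in>UNIV. b ^ load T h y) = CARD('b) + real (\<Sum>y\<in>UNIV. load T h y) * (b - 1)"
    by (simp add: sum.distrib sum_distrib_right)
  then show ?thesis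
    by (simp add: load_pgf_def sum_load assms add_divide_distrib)
qed

lemma mean_ln_le_ln_mean:
  fixes f :: "'a::finite \<Rightarrow> real"
  assumes "\<And>a. f a > 0"
  shows "(\<Sum>a\<in>UNIV. ln (f a)) / CARD('a) \<le> ln ((\<Sum>a\<in>UNIV. f a) / CARD('a))"
  using concave_on_sum[OF _ _ ln_concave, of UNIV "\<lambda>_. 1 / CARD('a)" f] assms
  by (simp flip: sum_divide_distrib)

definition shift_on :: "'a set \<Rightarrow> 'b \<Rightarrow> ('a \<Rightarrow> 'b) \<Rightarrow> 'a \<Rightarrow> 'b::plus" where
  "shift_on A a h = (\<lambda>x. if x \<in> A then h x + a else h x)"

lemma shift_on_uminus_cancel:
  fixes a :: "'b::group_add"
  shows "shift_on A (- a) (shift_on A a h) = h" and "shift_on A a (shift_on A (- a) h) = h"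
  by (auto simp: shift_on_def add.assoc)

lemma map_pmf_of_set_shift_on:
  fixes a :: "'b::group_add"
  assumes "finite H" "H \<noteq> {}" and closed: "\<And>a h. h \<in> H \<Longrightarrow> shift_on A a h \<in> H"
  shows "map_pmf (shift_on A a) (pmf_of_set H) = pmf_of_set H"
proof (rule map_pmf_of_set_bij_betw)
  show "bij_betw (shift_on A a) H H"
    by (rule bij_betw_byWitness[where f' = "shift_on A (- a)"])
      (auto simp: shift_on_uminus_cancel closed)
qed fact+

lemma load_shift_on:
  fixes h :: "'a \<Rightarrow> 'b::group_add"
  assumes "finite T"
  shows "load T (shift_on A a h) y = load (T \<inter> A) h (y - a) + load (T - A) h y"
proof -
  have "shift_on A a h -` {y} \<inter> T = (h -` {y - a} \<inter> (T \<inter> A)) \<union> (h -` {y} \<inter> (T - A))"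
    by (auto simp: shift_on_def eq_diff_eq split: if_splits)
  then show ?thesis
    unfolding load_def using assms by (subst card_Un_disjoint[symmetric]) auto
qed

lemma mean_load_pgf_shift_on:
  fixes h :: "'a \<Rightarrow> 'b::{finite,group_add}"
  assumes "finite T"
  shows "(\<Sum>a\<in>UNIV. load_pgf b T (shift_on A a h)) / CARD('b) =
    load_pgf b (T \<inter> A) h * load_pgf b (T - A) h"
proof -
  have translate: "(\<Sum>a\<in>UNIV. f (y - a)) = (\<Sum>z\<in>UNIV. f z)" for f :: "'b \<Rightarrow> real" and y
    by (rule sum.reindex_bij_witness[of _ "\<lambda>z. - z + y" "\<lambda>a. y - a"])
      (simp_all add: diff_conv_add_uminus minus_add add.assoc del: add_uminus_conv_diff)
  have "(\<Sum>a\<in>UNIV. \<Sum>y\<in>UNIV. b ^ load T (shift_on A a h) y) =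
      (\<Sum>y\<in>UNIV. \<Sum>a\<in>UNIV. b ^ load (T \<inter> A) h (y - a) * b ^ load (T - A) h y)"
    by (subst sum.swap) (simp add: load_shift_on assms power_add)
  also have "\<dots> = (\<Sum>z\<in>UNIV. b ^ load (T \<inter> A) h z) * (\<Sum>y\<in>UNIV. b ^ load (T - A) h y)"
    by (simp add: translate[where f = "\<lambda>z. b ^ load (T \<inter> A) h z"] sum_distrib_left
        flip: sum_distrib_right)
  finally show ?thesis
    by (simp add: load_pgf_def flip: sum_divide_distrib)
qed

lemma integrable_ln_load_pgf:
  fixes b :: real and f :: "'c \<Rightarrow> 'a \<Rightarrow> 'b::finite"
  assumes "b \<ge> 1" "finite T"
  shows "integrable (measure_pmf p) (\<lambda>x. ln (load_pgf b T (f x)))"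
proof (rule measure_pmf.integrable_const_bound)
  have "\<bar>ln (load_pgf b T h)\<bar> \<le> ln (b ^ card T)" for h :: "'a \<Rightarrow> 'b"
    using load_pgf_ge_1[OF assms(1), of T h] load_pgf_le_power_card[OF assms, of h] by simp
  then show "AE x in measure_pmf p. norm (ln (load_pgf b T (f x))) \<le> ln (b ^ card T)"
    by simp
qed simp

lemma integrable_max_load:
  fixes f :: "'c \<Rightarrow> 'a \<Rightarrow> 'b::finite"
  assumes "finite T"
  shows "integrable (measure_pmf p) (\<lambda>x. real (max_load T (f x)))"
proof (rule measure_pmf.integrable_const_bound)
  show "AE x in measure_pmf p. norm (real (max_load T (f x))) \<le> card T"
    by (simp add: max_load_le_card assms)
qed simp

definition mean_ln_load_pgf :: "('a \<Rightarrow> 'b) pmf \<Rightarrow> real \<Rightarrow> 'a set \<Rightarrow> real" where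
  "mean_ln_load_pgf p b T = measure_pmf.expectation p (\<lambda>h. ln (load_pgf b T h))"

lemma mean_ln_load_pgf_split:
  fixes b :: real and p :: "('a \<Rightarrow> 'b::{finite,group_add}) pmf"
  assumes "b \<ge> 1" "finite T" and invariant: "\<And>a. map_pmf (shift_on A a) p = p"
  shows "mean_ln_load_pgf p b T \<le> mean_ln_load_pgf p b (T \<inter> A) + mean_ln_load_pgf p b (T - A)"
proof -
  have pointwise: "(\<Sum>a\<in>UNIV. ln (load_pgf b T (shift_on A a h))) / CARD('b) \<le>
      ln (load_pgf b (T \<inter> A) h) + ln (load_pgf b (T - A) h)" for h :: "'a \<Rightarrow> 'b"
  proof -
    have pos: "load_pgf b U g > 0" for U and g :: "'a \<Rightarrow> 'b"
      using assms(1) by (intro load_pgf_pos) simp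
    then show ?thesis
      using mean_ln_le_ln_mean[of "\<lambda>a. load_pgf b T (shift_on A a h)"]
      by (simp add: mean_load_pgf_shift_on assms(2) ln_mult_pos)
  qed
  have "mean_ln_load_pgf p b T =
      measure_pmf.expectation p (\<lambda>h. ln (load_pgf b T (shift_on A a h)))" for a
    unfolding mean_ln_load_pgf_def by (subst invariant[of a, symmetric]) simp
  then have "mean_ln_load_pgf p b T = (\<Sum>a\<in>(UNIV :: 'b set).
      measure_pmf.expectation p (\<lambda>h. ln (load_pgf b T (shift_on A a h)))) / CARD('b)"
    by simp
  also have "\<dots> = measure_pmf.expectation p
      (\<lambda>h. (\<Sum>a\<in>UNIV. ln (load_pgf b T (shift_on A a h))) / CARD('b))"
    by (simp add: Bochner_Integration.integral_sum integrable_ln_load_pgf assms)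
  also have "\<dots> \<le> measure_pmf.expectation p
      (\<lambda>h. ln (load_pgf b (T \<inter> A) h) + ln (load_pgf b (T - A) h))"
    using assms by (intro integral_mono pointwise Bochner_Integration.integrable_add
        integrable_divide Bochner_Integration.integrable_sum integrable_ln_load_pgf) auto
  also have "\<dots> = mean_ln_load_pgf p b (T \<inter> A) + mean_ln_load_pgf p b (T - A)"
    unfolding mean_ln_load_pgf_def using assms
    by (intro Bochner_Integration.integral_add integrable_ln_load_pgf) auto
  finally show ?thesis .
qed

lemma mean_ln_load_pgf_le_of_card_le_1:
  fixes b :: real and p :: "('a \<Rightarrow> 'b::finite) pmf"
  assumes "b \<ge> 1" "finite T" "card T \<le> 1"
  shows "mean_ln_load_pgf p b T \<le> card T * (b - 1) / CARD('b)"
proof -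
  have "inj_on h T" for h :: "'a \<Rightarrow> 'b"
    using assms(2,3) by (auto intro: inj_onI simp: card_le_Suc0_iff_eq)
  then have "mean_ln_load_pgf p b T = ln (1 + card T * (b - 1) / CARD('b))"
    by (simp add: mean_ln_load_pgf_def load_pgf_inj_on assms(2))
  also have "\<dots> \<le> card T * (b - 1) / CARD('b)"
    using assms(1) by (intro ln_add_one_self_le_self) simp
  finally show ?thesis .
qed

locale separating_shift_invariant_pmf =
  fixes p :: "('a \<Rightarrow> 'b::{finite,group_add}) pmf" and \<A> :: "'a set set"
  assumes map_shift_on: "A \<in> \<A> \<Longrightarrow> map_pmf (shift_on A a) p = p"
    and separated: "x \<noteq> y \<Longrightarrow> \<exists>A\<in>\<A>. x \<in> A \<longleftrightarrow> y \<notin> A"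
begin

lemma mean_ln_load_pgf_le:
  fixes b :: real
  assumes "b \<ge> 1" "finite T"
  shows "mean_ln_load_pgf p b T \<le> card T * (b - 1) / CARD('b)"
  using assms(2)
proof (induction T rule: finite_psubset_induct)
  case (psubset T)
  show ?case
  proof (cases "card T \<le> 1")
    case True
    with assms(1) psubset.hyps show ?thesis
      by (rule mean_ln_load_pgf_le_of_card_le_1)
  next
    case False
    then obtain x y where "x \<in> T" "y \<in> T" "x \<noteq> y"
      using psubset.hyps by (auto simp: card_le_Suc0_iff_eq)
    moreover from this obtain A where A: "A \<in> \<A>" "x \<in> A \<longleftrightarrow> y \<notin> A"
      using separated by blast
    ultimately have "T \<inter> A \<subset> T" "T - A \<subset> T"
      by blast+
    then have "mean_ln_load_pgf p b (T \<inter> A) + mean_ln_load_pgf p b (T - A) \<le>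
        card (T \<inter> A) * (b - 1) / CARD('b) + card (T - A) * (b - 1) / CARD('b)"
      by (intro add_mono psubset.IH)
    also have "\<dots> = card T * (b - 1) / CARD('b)"
      unfolding card_Int_Diff[OF psubset.hyps, of A]
      by (simp add: distrib_right add_divide_distrib)
    finally show ?thesis
      using mean_ln_load_pgf_split[OF assms(1) psubset.hyps map_shift_on[OF A(1)]] by linarith
  qed
qed

theorem expectation_max_load_le:
  fixes b :: real
  assumes "b > 1" "finite T"
  shows "measure_pmf.expectation p (\<lambda>h. real (max_load T h)) \<le>
    (ln CARD('b) + card T * (b - 1) / CARD('b)) / ln b"
proof -
  have integrable: "integrable (measure_pmf p) (\<lambda>h. ln (load_pgf b T h))"
    using assms by (intro integrable_ln_load_pgf) simp_all
  have "measure_pmf.expectation p (\<lambda>h. real (max_load T h)) \<le>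
      measure_pmf.expectation p (\<lambda>h. (ln CARD('b) + ln (load_pgf b T h)) / ln b)"
  proof (rule integral_mono)
    show "integrable (measure_pmf p) (\<lambda>h. real (max_load T h))"
      by (rule integrable_max_load) (rule assms(2))
    show "integrable (measure_pmf p) (\<lambda>h. (ln CARD('b) + ln (load_pgf b T h)) / ln b)"
      using integrable by simp
  qed (intro max_load_le_ln_load_pgf assms(1))
  also have "\<dots> = (ln CARD('b) + mean_ln_load_pgf p b T) / ln b"
    using integrable by (simp add: mean_ln_load_pgf_def)
  also have "\<dots> \<le> (ln CARD('b) + card T * (b - 1) / CARD('b)) / ln b"
    using assms by (intro divide_right_mono add_left_mono mean_ln_load_pgf_le) auto
  finally show ?thesis .
qed

end

lemma linear_maps_shift_on:
  assumes "h \<in> linear_maps"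
  shows "shift_on {x. x $ i = 1} a h \<in> linear_maps"
proof -
  have "shift_on {x. x $ i = 1} a h = (\<lambda>x. h x + x $ i *s a)"
  proof
    fix x
    show "shift_on {x. x $ i = 1} a h x = h x + x $ i *s a"
      by (cases "x $ i") (simp_all add: shift_on_def)
  qed
  moreover have "Vector_Spaces.linear (*s) (*s) (\<lambda>x :: bit ^ 'a. x $ i *s a)"
    by unfold_locales
      (simp_all only: vector_add_component vector_smult_component
        vec.scale_left_distrib vec.scale_scale)
  ultimately show ?thesis
    using assms unfolding linear_maps_def by (auto intro: vec.linear_compose_add)
qed

interpretation linear_maps: separating_shift_invariant_pmf
  "pmf_of_set (linear_maps :: (bit ^ 'u::finite \<Rightarrow> bit ^ 'l::finite) set)"
  "range (\<lambda>i. {x. x $ i = 1})"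
proof
  fix A :: "(bit ^ 'u) set" and a :: "bit ^ 'l"
  assume "A \<in> range (\<lambda>i. {x. x $ i = 1})"
  then obtain i where "A = {x. x $ i = 1}"
    by blast
  then show "map_pmf (shift_on A a) (pmf_of_set linear_maps) = pmf_of_set linear_maps"
    by (simp only: map_pmf_of_set_shift_on[OF finite_linear_maps linear_maps_nonempty
          linear_maps_shift_on])
next
  fix x y :: "bit ^ 'u"
  assume "x \<noteq> y"
  then obtain i where "x $ i \<noteq> y $ i"
    by (auto simp: vec_eq_iff)
  then have "x \<in> {x. x $ i = 1} \<longleftrightarrow> y \<notin> {x. x $ i = 1}"
    by (cases "x $ i"; cases "y $ i") simp_all
  then show "\<exists>A\<in>range (\<lambda>i. {x. x $ i = 1}). x \<in> A \<longleftrightarrow> y \<notin> A"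
    by (rule bexI[OF _ rangeI])
qed

lemma card_bit_vec: "CARD(bit ^ 'l::finite) = 2 ^ CARD('l)"
proof -
  have "(UNIV :: bit set) = {0, 1}"
    using bit.exhaust by blast
  then have "CARD(bit) = 2"
    by (metis card_2_iff zero_neq_one)
  then show ?thesis
    by simp
qed

lemma opt_base_ge_2:
  assumes "m > 0" and "real m \<le> 1 / 2 * real n * log 2 (real n)"
  shows "real n * log 2 (real n) / real m \<ge> 2"
  using assms by (simp add: field_simps)

lemma opt_nonneg:
  assumes "m > 0" "n > 0"
  shows "opt m n \<ge> 0"
proof (cases "real m \<le> 1 / 2 * real n * log 2 (real n)")
  case True
  then have "log 2 (real n * log 2 (real n) / real m) \<ge> 0"
    using opt_base_ge_2[OF assms(1) True] by simp
  with True assms show ?thesis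
    by (simp add: opt_def zero_le_log_cancel_iff)
qed (simp add: opt_def)

lemma opt_bound_small:
  assumes "m > 0" "n > 1" and small: "real m \<le> 1 / 2 * real n * log 2 (real n)"
  defines "b \<equiv> real n * log 2 (real n) / real m"
  shows "(ln n + m * (b - 1) / n) / ln b \<le> 4 * opt m n"
proof -
  have "b \<ge> 2"
    unfolding b_def using assms(1) small by (rule opt_base_ge_2)
  have "m * (b - 1) / n \<le> log 2 n"
    using assms(1,2) by (simp add: b_def field_simps)
  also have "\<dots> \<le> 3 * ln n"
    using ln2_ge_two_thirds assms(2) by (simp add: log_def field_simps)
  finally have "(ln n + m * (b - 1) / n) / ln b \<le> 4 * ln n / ln b"
    using \<open>b \<ge> 2\<close> assms(2) by (intro divide_right_mono) auto
  also have "\<dots> = 4 * (log 2 n / log 2 b)"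
    by (simp add: log_def)
  also have "\<dots> = 4 * opt m n"
    using small by (simp add: opt_def b_def)
  finally show ?thesis .
qed

lemma opt_bound_large:
  assumes "n > 0" and large: "real m > 1 / 2 * real n * log 2 (real n)"
  shows "(ln n + m / n) / ln 2 \<le> 4 * opt m n"
proof -
  define r where "r = real m / real n"
  have "log 2 n \<le> 2 * r"
    using assms by (simp add: r_def field_simps)
  moreover have "r \<ge> 0"
    by (simp add: r_def)
  moreover from this have "r / ln 2 \<le> 3 / 2 * r"
    using ln2_ge_two_thirds divide_left_mono[of "2 / 3" "ln 2" r] by simp
  ultimately have "log 2 n + r / ln 2 \<le> 4 * r"
    by linarith
  moreover have "opt m n = r"
    using large by (simp add: opt_def r_def)
  ultimately show ?thesis
    by (simp add: add_divide_distrib log_def flip: r_def)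
qed

lemma obtain_opt_base:
  assumes "m > 0" "n > 1"
  obtains b :: real where "b > 1" "(ln n + m * (b - 1) / n) / ln b \<le> 4 * opt m n"
proof (cases "real m \<le> 1 / 2 * real n * log 2 (real n)")
  case True
  show thesis
    using opt_base_ge_2[OF assms(1) True]
    by (intro that[OF _ opt_bound_small[OF assms True]]) simp
next
  case False
  then show thesis
    using assms(2) opt_bound_large[of n m] that[of 2] by simp
qed

theorem theorem1p2:
  fixes S :: "(bit ^ 'u) set" and m n :: nat
  assumes "CARD('l::finite) \<le> CARD('u::finite)"
    and "1 \<le> m" and "m \<le> 2 ^ CARD('u)"
    and "n = 2 ^ CARD('l)"
    and "card S = m"
  shows "measure_pmf.expectation (pmf_of_set (linear_maps :: (bit ^ 'u \<Rightarrow> bit ^ 'l) set))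
           (\<lambda>h. real (MAX y\<in>UNIV. card (h -` {y} \<inter> S)))
         \<le> 16 * opt m n"
proof -
  have n: "CARD(bit ^ 'l) = n"
    using assms(4) by (simp only: card_bit_vec)
  have "m > 0"
    using assms(2) by simp
  moreover have "n > 1"
    unfolding assms(4) by (rule one_less_power) simp_all
  ultimately obtain b :: real where b: "b > 1" "(ln n + m * (b - 1) / n) / ln b \<le> 4 * opt m n"
    by (rule obtain_opt_base)
  have "measure_pmf.expectation (pmf_of_set (linear_maps :: (bit ^ 'u \<Rightarrow> bit ^ 'l) set))
      (\<lambda>h. real (max_load S h)) \<le>
      (ln CARD(bit ^ 'l) + card S * (b - 1) / CARD(bit ^ 'l)) / ln b"
    using b(1) by (rule linear_maps.expectation_max_load_le) simp
  also have "\<dots> = (ln n + m * (b - 1) / n) / ln b"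
    by (simp only: n assms(5))
  also have "\<dots> \<le> 16 * opt m n"
    using b(2) opt_nonneg[of m n] \<open>m > 0\<close> \<open>n > 1\<close> by simp
  finally show ?thesis
    by (simp only: max_load_def load_def)
qed

end
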